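(* Let $F(w)=\mathbb{E}[f(w;\xi)]$, $w\in\mathbb{R}^d$. Assume: (1) $F$ is $\mu$-strongly convex for some $\mu>0$; (2) for every realization of $\xi$, $f(\cdot;\xi)$ is $L$-smooth, with a common constant $L>0$ (the functions $f(\cdot;\xi)$ need not be convex). Let $\kappa=\frac{L}{\mu}$, let $w_*$ be the unique minimizer of $F$, and assume $\mathbb{E}[\|\nabla f(w_*;\xi)\|^2]<\infty$. Consider the SGD iteration $w_{t+1}=w_t-\eta_t\nabla f(w_t;\xi_t)$, $t\ge 0$, started from a given $w_0\in\mathbb{R}^d$, with a step size sequence satisfying $$0<\eta_t\le \frac{1}{2L\kappa}\ \ (t\ge 0),\qquad \sum_{t=0}^\infty \eta_t=\infty,\qquad \sum_{t=0}^\infty \eta_t^2<\infty .$$ Then, with probability one, $\|w_t-w_*\|^2\to 0$ as $t\to\infty$.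
   Context: $\xi$ is a random variable with some distribution, and $f(\cdot;\xi):\mathbb{R}^d\to\mathbb{R}$ is differentiable for each realization of $\xi$. The stochastic gradient is unbiased: $\mathbb{E}[\nabla f(w;\xi)]=\nabla F(w)$ for every fixed $w$. The variables $\xi_0,\xi_1,\dots$ are i.i.d. copies of $\xi$. The step sizes $\eta_t$ are deterministic. $\|\cdot\|$ is the Euclidean norm. $\mu$-strongly convex: $F(w)-F(w')\ge\langle\nabla F(w'),w-w'\rangle+\frac{\mu}{2}\|w-w'\|^2$ for all $w,w'\in\mathbb{R}^d$. $L$-smooth: $\|\nabla f(w;\xi)-\nabla f(w';\xi)\|\le L\|w-w'\|$ for all $w,w'\in\mathbb{R}^d$. *)

theory Defs
  imports "HOL-Probability.Probability"
begin

definition grad :: "('a::euclidean_space \<Rightarrow> real) \<Rightarrow> 'a \<Rightarrow> 'a" where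
  "grad g x = (THE D. GDERIV g x :> D)"

lemma grad_unique:
  assumes "GDERIV g x :> D"
  shows "grad g x = D"
  unfolding grad_def
proof (rule the_equality[where P = "\<lambda>D. GDERIV g x :> D", OF assms])
  fix D' assume "GDERIV g x :> D'"
  then have "(\<lambda>h. h \<bullet> D') = (\<lambda>h. h \<bullet> D)"
    using assms has_derivative_unique[of g _ x "\<lambda>h. h \<bullet> D"] unfolding gderiv_def by simp
  then have "\<forall>h. h \<bullet> D' = h \<bullet> D"
    by (simp add: fun_eq_iff)
  then show "D' = D"
    using vector_eq_ldot vector_eq_rdot by blast
qed

lemma GDERIV_grad:
  fixes g :: "'a::euclidean_space \<Rightarrow> real"
  assumes "g differentiable (at x)"
  shows "GDERIV g x :> grad g x"
proof -
  obtain g' where g': "(g has_derivative g') (at x)"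
    using assms by (auto simp: differentiable_def)
  then interpret bounded_linear g' by (rule has_derivative_bounded_linear)
  have rep: "g' h = h \<bullet> (\<Sum>b\<in>Basis. g' b *\<^sub>R b)" for h
  proof -
    have "g' h = g' (\<Sum>b\<in>Basis. (h \<bullet> b) *\<^sub>R b)"
      by (simp add: euclidean_representation)
    also have "\<dots> = (\<Sum>b\<in>Basis. (h \<bullet> b) * g' b)"
      by (simp add: sum scaleR)
    also have "\<dots> = h \<bullet> (\<Sum>b\<in>Basis. g' b *\<^sub>R b)"
      by (simp add: inner_sum_right mult.commute)
    finally show ?thesis .
  qed
  have "(\<lambda>h. h \<bullet> (\<Sum>b\<in>Basis. g' b *\<^sub>R b)) = g'"
    by (intro ext) (rule rep[symmetric])
  with g' have "GDERIV g x :> (\<Sum>b\<in>Basis. g' b *\<^sub>R b)"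
    unfolding gderiv_def by (simp only:)
  then show ?thesis
    by (simp only: grad_unique)
qed

definition strongly_convex :: "real \<Rightarrow> ('a::euclidean_space \<Rightarrow> real) \<Rightarrow> bool" where
  "strongly_convex \<mu> F \<longleftrightarrow> (\<forall>w. F differentiable (at w)) \<and>
     (\<forall>w w'. F w - F w' \<ge> grad F w' \<bullet> (w - w') + \<mu> / 2 * (norm (w - w'))\<^sup>2)"

definition smooth :: "real \<Rightarrow> ('a::euclidean_space \<Rightarrow> real) \<Rightarrow> bool" where
  "smooth L g \<longleftrightarrow> (\<forall>w. g differentiable (at w)) \<and>
     (\<forall>w w'. norm (grad g w - grad g w') \<le> L * norm (w - w'))"

text \<open>Here \<open>D\<close> is the law of the random variable \<open>\<xi>\<close>, so that expectations of functions of
  \<open>\<xi>\<close> are integrals with respect to \<open>D\<close>, and \<open>space D\<close> is the set of its possible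
  realizations.\<close>

definition objective :: "'s measure \<Rightarrow> ('a \<Rightarrow> 's \<Rightarrow> real) \<Rightarrow> 'a \<Rightarrow> real" where
  "objective D f w = (\<integral>x. f w x \<partial>D)"

text \<open>Integrability is stated explicitly because the Bochner integral of a non-integrable
  function is \<open>0\<close>, and differentiability of the objective because \<open>grad\<close> is unspecified
  otherwise.\<close>

definition unbiased_gradient :: "'s measure \<Rightarrow> ('a::euclidean_space \<Rightarrow> 's \<Rightarrow> real) \<Rightarrow> bool" where
  "unbiased_gradient D f \<longleftrightarrow> (\<forall>w.
     objective D f differentiable (at w) \<and>
     integrable D (\<lambda>x. grad (\<lambda>v. f v x) w) \<and>
     (\<integral>x. grad (\<lambda>v. f v x) w \<partial>D) = grad (objective D f) w)"

primrec sgd ::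
  "('a::euclidean_space \<Rightarrow> 's \<Rightarrow> real) \<Rightarrow> (nat \<Rightarrow> real) \<Rightarrow> (nat \<Rightarrow> 's) \<Rightarrow> 'a \<Rightarrow> nat \<Rightarrow> 'a" where
  "sgd f \<eta> x w0 0 = w0"
| "sgd f \<eta> x w0 (Suc t) =
     sgd f \<eta> x w0 t - \<eta> t *\<^sub>R grad (\<lambda>v. f v (x t)) (sgd f \<eta> x w0 t)"

lemma strongly_convex_ex1_minimizer:
  fixes F :: "'a::euclidean_space \<Rightarrow> real"
  assumes sc: "strongly_convex \<mu> F" and "\<mu> > 0"
  shows "\<exists>!w. is_arg_min F (\<lambda>_. True) w"
proof -
  have lower: "F w \<ge> F v + grad F v \<bullet> (w - v) + \<mu> / 2 * (norm (w - v))\<^sup>2" for v w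
  proof -
    have "grad F v \<bullet> (w - v) + \<mu> / 2 * (norm (w - v))\<^sup>2 \<le> F w - F v"
      using sc unfolding strongly_convex_def by blast
    then show ?thesis by linarith
  qed
  have cont: "continuous_on S F" for S
    using sc unfolding strongly_convex_def
    by (intro continuous_at_imp_continuous_on ballI differentiable_imp_continuous_within) blast
  define R where "R = 2 * norm (grad F 0) / \<mu>"
  have "R \<ge> 0" using \<open>\<mu> > 0\<close> by (simp add: R_def)
  then have "0 \<in> cball (0::'a) R" by simp
  obtain m where m: "m \<in> cball 0 R" "\<And>w. w \<in> cball 0 R \<Longrightarrow> F m \<le> F w"
    using continuous_attains_inf[OF compact_cball _ cont] \<open>0 \<in> cball (0::'a) R\<close> by blast
  have min: "F m \<le> F w" for w
  proof (cases "w \<in> cball 0 R")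
    case True
    then show ?thesis using m by blast
  next
    case False
    then have "R < norm w" by simp
    then have "norm (grad F 0) \<le> \<mu> / 2 * norm w"
      using \<open>\<mu> > 0\<close> by (simp add: R_def field_simps)
    then have "norm (grad F 0) * norm w \<le> \<mu> / 2 * norm w * norm w"
      by (rule mult_right_mono) simp
    moreover have "\<bar>grad F 0 \<bullet> w\<bar> \<le> norm (grad F 0) * norm w"
      by (rule Cauchy_Schwarz_ineq2)
    ultimately have "F 0 \<le> F w"
      using lower[of 0 w] by (simp add: power2_eq_square)
    moreover have "F m \<le> F 0" using m \<open>0 \<in> cball (0::'a) R\<close> by blast
    ultimately show ?thesis by linarith
  qed
  have uniq: "w = m" if w: "\<And>v. F w \<le> F v" for w
  proof (rule ccontr)
    assume "w \<noteq> m"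
    define c where "c = (1/2) *\<^sub>R (w + m)"
    have 1: "w - c = (1/2) *\<^sub>R (w - m)" and 2: "m - c = - (w - c)"
      unfolding c_def by (simp_all add: algebra_simps flip: scaleR_add_left)
    have "w - c \<noteq> 0" using 1 \<open>w \<noteq> m\<close> by simp
    then have "\<mu> / 2 * (norm (w - c))\<^sup>2 > 0" using \<open>\<mu> > 0\<close> by simp
    moreover have "F m \<ge> F c - grad F c \<bullet> (w - c) + \<mu> / 2 * (norm (w - c))\<^sup>2"
      using lower[of c m] unfolding 2
      by (simp only: norm_minus_cancel inner_minus_right diff_conv_add_uminus)
    moreover have "F w \<ge> F c + grad F c \<bullet> (w - c) + \<mu> / 2 * (norm (w - c))\<^sup>2"
      by (rule lower)
    ultimately show False using w[of c] min[of c] by linarith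
  qed
  show ?thesis
  proof (rule ex1I[of _ m])
    show "is_arg_min F (\<lambda>_. True) m"
      using min by (simp add: is_arg_min_linorder)
    show "w = m" if "is_arg_min F (\<lambda>_. True) w" for w
      using that uniq by (simp add: is_arg_min_linorder)
  qed
qed

end

theory Submission
  imports Defs
begin

text \<open>Write \<open>Y\<^sub>t = \<parallel>w\<^sub>t - w\<^sub>*\<parallel>\<^sup>2\<close> and \<open>N = E \<parallel>\<nabla>f(w\<^sub>*; \<xi>)\<parallel>\<^sup>2\<close>. Strong convexity, smoothness and the step size bound give
  \<open>E[Y\<^sub>t\<^sub>+\<^sub>1 | \<xi>\<^sub>0, \<dots>, \<xi>\<^sub>t\<^sub>-\<^sub>1] \<le> (1 - \<mu> \<eta>\<^sub>t) Y\<^sub>t + 2 N \<eta>\<^sub>t\<^sup>2\<close>.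
  Taking expectations, \<open>E Y\<^sub>t \<rightarrow> 0\<close>. Moreover \<open>S\<^sub>t = Y\<^sub>t + 2 N \<Sum>\<^sub>s\<^sub>\<ge>\<^sub>t \<eta>\<^sub>s\<^sup>2\<close> is a nonnegative
  supermartingale with \<open>E S\<^sub>t \<rightarrow> 0\<close>, so the maximal inequality
  \<open>\<epsilon> P(\<exists>t \<ge> T. S\<^sub>t \<ge> \<epsilon>) \<le> E S\<^sub>T\<close> yields almost sure convergence without any martingale
  convergence theorem.\<close>

section \<open>Supermartingale convergence\<close>

text \<open>The perturbations have finite total, so removing the ones accumulated so far leaves a
  decreasing sequence bounded below, and \<open>a\<close> has a limit. Telescoping also bounds the
  sums of \<open>c t * a t\<close>; a positive limit would then bound the sums of \<open>c\<close>,
  against their divergence.\<close>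

lemma perturbed_contraction_tendsto_zero:
  fixes a c e :: "nat \<Rightarrow> real"
  assumes a: "\<And>t. 0 \<le> a t" and c: "\<And>t. 0 \<le> c t" and e: "\<And>t. 0 \<le> e t" "summable e"
    and div: "filterlim (\<lambda>n. \<Sum>t<n. c t) at_top sequentially"
    and step: "\<And>t. a (Suc t) + c t * a t \<le> a t + e t"
  shows "a \<longlonglongrightarrow> 0"
proof -
  define b where "b n = a n - (\<Sum>t<n. e t)" for n
  have telescoped: "b n + (\<Sum>t<n. c t * a t) \<le> a 0" for n
  proof (induction n)
    case (Suc n)
    then show ?case using step[of n] by (simp add: b_def)
  qed (simp add: b_def)
  have "decseq b"
  proof (rule decseq_SucI)
    show "b (Suc n) \<le> b n" for n
      using step[of n] mult_nonneg_nonneg[OF c a, of n n] by (simp add: b_def)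
  qed
  have sum_le: "(\<Sum>t<n. e t) \<le> suminf e" for n
    using e by (intro sum_le_suminf) auto
  have b_lower: "- suminf e \<le> b n" for n
    using a[of n] sum_le[of n] by (simp add: b_def)
  obtain l where "b \<longlonglongrightarrow> l"
    using decseq_convergent[OF \<open>decseq b\<close>] b_lower by blast
  then have "(\<lambda>n. b n + (\<Sum>t<n. e t)) \<longlonglongrightarrow> l + suminf e"
    by (intro tendsto_add summable_LIMSEQ e)
  then have lim: "a \<longlonglongrightarrow> l + suminf e"
    by (simp add: b_def)
  moreover have "l + suminf e = 0"
  proof (rule ccontr)
    \<comment> \<open>Half of the supposed limit lies strictly between 0 and the limit, so
      \<open>a\<close> eventually stays above it.\<close>
    define h where "h = (l + suminf e) / 2"
    assume "l + suminf e \<noteq> 0"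
    moreover have "0 \<le> l + suminf e"
      using lim a by (intro LIMSEQ_le_const) auto
    ultimately have h: "0 < h" "h < l + suminf e" by (auto simp: h_def)
    obtain N where N: "\<And>t. t \<ge> N \<Longrightarrow> h < a t"
      using order_tendstoD(1)[OF lim h(2)] by (auto simp: eventually_sequentially)
    \<comment> \<open>The right-hand side does not depend on \<open>n\<close>: only the first
      \<open>N\<close> weights, where \<open>a t\<close> may be below \<open>h\<close>, are paid for
      separately.\<close>
    have "h * (\<Sum>t<n. c t) \<le> a 0 + suminf e + h * (\<Sum>t<N. c t)" if "n \<ge> N" for n
    proof -
      have split: "(\<Sum>t<n. u t) = (\<Sum>t<N. u t) + (\<Sum>t=N..<n. u t)" for u :: "nat \<Rightarrow> real"
        using that by (simp add: lessThan_atLeast0 sum.atLeastLessThan_concat)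
      have "h * (\<Sum>t=N..<n. c t) \<le> (\<Sum>t=N..<n. c t * a t)"
        unfolding sum_distrib_left
      proof (rule sum_mono)
        fix t assume "t \<in> {N..<n}"
        then have "h \<le> a t" using N[of t] by simp
        then show "h * c t \<le> c t * a t" using c[of t] by (metis mult.commute mult_left_mono)
      qed
      also have "\<dots> \<le> (\<Sum>t<n. c t * a t)"
        unfolding split[of "\<lambda>t. c t * a t"] using a c by (simp add: sum_nonneg)
      also have "\<dots> \<le> a 0 + suminf e"
        using telescoped[of n] b_lower[of n] by linarith
      finally show ?thesis unfolding split[of c] by (simp add: distrib_left)
    qed
    moreover have "eventually (\<lambda>n. (a 0 + suminf e + h * (\<Sum>t<N. c t)) / h < (\<Sum>t<n. c t)) sequentially"
      using div by (simp add: filterlim_at_top_dense)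
    then have "eventually (\<lambda>n. (a 0 + suminf e + h * (\<Sum>t<N. c t)) / h < (\<Sum>t<n. c t) \<and> n \<ge> N) sequentially"
      using eventually_ge_at_top[of N] by eventually_elim auto
    then obtain n where "(a 0 + suminf e + h * (\<Sum>t<N. c t)) / h < (\<Sum>t<n. c t)" "n \<ge> N"
      by (auto simp: eventually_sequentially)
    ultimately show False
      using h(1) by (auto simp: divide_less_eq mult.commute not_less[symmetric])
  qed
  ultimately show ?thesis by simp
qed

text \<open>The supermartingale property is stated by integrals over the events of \<open>F n\<close>,
  so that no conditional expectations are needed and \<open>S\<close> may take the value \<open>\<infinity>\<close>.\<close>

lemma supermartingale_maximal_inequality:
  fixes S :: "nat \<Rightarrow> 'a \<Rightarrow> ennreal"
  assumes sub: "\<And>n. subalgebra M (F n)" and mono: "\<And>n. subalgebra (F (Suc n)) (F n)"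
    and adapted: "\<And>n. S n \<in> borel_measurable (F n)"
    and step: "\<And>n B. B \<in> sets (F n) \<Longrightarrow> (\<integral>\<^sup>+\<omega>\<in>B. S (Suc n) \<omega> \<partial>M) \<le> (\<integral>\<^sup>+\<omega>\<in>B. S n \<omega> \<partial>M)"
  shows "\<epsilon> * emeasure M {\<omega> \<in> space M. \<exists>t\<ge>T. \<epsilon> \<le> S t \<omega>} \<le> (\<integral>\<^sup>+\<omega>. S T \<omega> \<partial>M)"
proof -
  have [measurable]: "S n \<in> borel_measurable M" for n
    using measurable_from_subalg[OF sub adapted] .
  have sp: "space (F n) = space M" for n
    using sub[of n] by (simp add: subalgebra_def)
  \<comment> \<open>The crossing of the level \<open>\<epsilon>\<close> is first studied on the
    finite window from \<open>T\<close> to \<open>T + k\<close>, where it is an event of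
    \<open>F (T + k)\<close>.\<close>
  define A where "A k = {\<omega> \<in> space M. \<exists>j\<le>k. \<epsilon> \<le> S (T + j) \<omega>}" for k
  have F_mono: "sets (F n) \<subseteq> sets (F m)" if "n \<le> m" for n m
    using mono by (intro lift_Suc_mono_le[OF _ that, of "\<lambda>n. sets (F n)"]) (auto simp: subalgebra_def)
  have A_F: "A k \<in> sets (F (T + k))" for k
  proof -
    have "{\<omega> \<in> space M. \<epsilon> \<le> S (T + j) \<omega>} \<in> sets (F (T + k))" if "j \<le> k" for j
    proof -
      have "{\<omega> \<in> space (F (T + j)). \<epsilon> \<le> S (T + j) \<omega>} \<in> sets (F (T + j))"
        using adapted[of "T + j"] by measurable
      then show ?thesis using F_mono[of "T + j" "T + k"] that sp by auto
    qed
    then have "(\<Union>j\<in>{..k}. {\<omega> \<in> space M. \<epsilon> \<le> S (T + j) \<omega>}) \<in> sets (F (T + k))"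
      by (intro sets.finite_UN) auto
    moreover have "A k = (\<Union>j\<in>{..k}. {\<omega> \<in> space M. \<epsilon> \<le> S (T + j) \<omega>})"
      by (auto simp: A_def)
    ultimately show ?thesis by simp
  qed
  have A_M [measurable]: "A k \<in> sets M" for k
    using A_F sub by (auto simp: subalgebra_def)
  have compl_F: "space M - A k \<in> sets (F (T + k))" for k
    using A_F[of k] sp by (metis sets.compl_sets)
  \<comment> \<open>The left side is the expectation at time \<open>T + k\<close> of the process
    stopped at its first crossing after \<open>T\<close>, with the value at the crossing lowered to
    \<open>\<epsilon>\<close>. Induction on \<open>k\<close> shows that stopping never raises it
    above the initial expectation.\<close>
  have stopped: "\<epsilon> * emeasure M (A k) + (\<integral>\<^sup>+\<omega>\<in>space M - A k. S (T + k) \<omega> \<partial>M) \<le> (\<integral>\<^sup>+\<omega>. S T \<omega> \<partial>M)" for k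
  proof (induction k)
    case 0
    have "\<epsilon> * emeasure M (A 0) + (\<integral>\<^sup>+\<omega>\<in>space M - A 0. S T \<omega> \<partial>M)
        = (\<integral>\<^sup>+\<omega>. \<epsilon> * indicator (A 0) \<omega> + S T \<omega> * indicator (space M - A 0) \<omega> \<partial>M)"
      by (subst nn_integral_add) (auto simp: nn_integral_cmult_indicator)
    also have "\<dots> \<le> (\<integral>\<^sup>+\<omega>. S T \<omega> \<partial>M)"
      by (intro nn_integral_mono) (auto simp: A_def indicator_def)
    finally show ?case by simp
  next
    case (Suc k)
    have "A k \<subseteq> A (Suc k)" by (auto simp: A_def le_Suc_eq)
    then have "emeasure M (A (Suc k)) = emeasure M (A k) + emeasure M (A (Suc k) - A k)"
      by (subst plus_emeasure) (auto intro!: arg_cong[where f = "emeasure M"])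
    then have "\<epsilon> * emeasure M (A (Suc k)) + (\<integral>\<^sup>+\<omega>\<in>space M - A (Suc k). S (T + Suc k) \<omega> \<partial>M)
        = \<epsilon> * emeasure M (A k) + (\<epsilon> * emeasure M (A (Suc k) - A k)
          + (\<integral>\<^sup>+\<omega>\<in>space M - A (Suc k). S (T + Suc k) \<omega> \<partial>M))"
      by (simp add: distrib_left add.assoc)
    \<comment> \<open>The paths crossing for the first time at \<open>T + Suc k\<close> and those
      that have not crossed yet partition the complement of \<open>A k\<close>. On the former
      \<open>S\<close> is at least \<open>\<epsilon>\<close>, so both terms merge into one integral
      over an event of \<open>F (T + k)\<close>, to which the supermartingale property
      applies.\<close>
    also have "\<epsilon> * emeasure M (A (Suc k) - A k) + (\<integral>\<^sup>+\<omega>\<in>space M - A (Suc k). S (T + Suc k) \<omega> \<partial>M)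
        = (\<integral>\<^sup>+\<omega>. \<epsilon> * indicator (A (Suc k) - A k) \<omega> + S (T + Suc k) \<omega> * indicator (space M - A (Suc k)) \<omega> \<partial>M)"
      by (subst nn_integral_add) (auto simp: nn_integral_cmult_indicator)
    also have "\<dots> \<le> (\<integral>\<^sup>+\<omega>\<in>space M - A k. S (Suc (T + k)) \<omega> \<partial>M)"
      by (intro nn_integral_mono) (auto simp: A_def indicator_def le_Suc_eq)
    also have "\<dots> \<le> (\<integral>\<^sup>+\<omega>\<in>space M - A k. S (T + k) \<omega> \<partial>M)"
      by (rule step[OF compl_F])
    finally show ?case using Suc.IH by (auto intro: order_trans add_left_mono)
  qed
  \<comment> \<open>The windows increase to the whole future, so continuity from below turns the
    finite-horizon bounds into the infinite-horizon one.\<close>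
  have "{\<omega> \<in> space M. \<exists>t\<ge>T. \<epsilon> \<le> S t \<omega>} = (\<Union>k. A k)"
    by (auto simp: A_def le_iff_add)
  moreover have "(SUP k. emeasure M (A k)) = emeasure M (\<Union>k. A k)"
    by (rule SUP_emeasure_incseq) (auto simp: incseq_def A_def intro: order_trans)
  ultimately have "\<epsilon> * emeasure M {\<omega> \<in> space M. \<exists>t\<ge>T. \<epsilon> \<le> S t \<omega>} = (SUP k. \<epsilon> * emeasure M (A k))"
    by (simp flip: SUP_mult_left_ennreal)
  also have "\<dots> \<le> (\<integral>\<^sup>+\<omega>. S T \<omega> \<partial>M)"
    using stopped by (intro SUP_least) (metis le_iff_add order_trans)
  finally show ?thesis .
qed

text \<open>The hypothesis \<open>step\<close> serves twice. With \<open>B\<close> the whole space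
  it is the recursion that drives the expectations to 0; for general \<open>B\<close>, with the
  \<open>c\<close> term dropped, it is the supermartingale property up to the error
  \<open>e\<close>. The contraction is written as a sum on the left because subtraction on
  \<open>ennreal\<close> truncates.\<close>

lemma (in prob_space) perturbed_contraction_AE_tendsto_zero:
  fixes Y :: "nat \<Rightarrow> 'a \<Rightarrow> real" and c e :: "nat \<Rightarrow> real"
  assumes sub: "\<And>n. subalgebra M (F n)" and mono: "\<And>n. subalgebra (F (Suc n)) (F n)"
    and adapted: "\<And>n. Y n \<in> borel_measurable (F n)"
    and Y: "\<And>n \<omega>. 0 \<le> Y n \<omega>" "(\<integral>\<^sup>+\<omega>. Y 0 \<omega> \<partial>M) < \<infinity>"
    and c: "\<And>n. 0 \<le> c n" "filterlim (\<lambda>n. \<Sum>t<n. c t) at_top sequentially"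
    and e: "\<And>n. 0 \<le> e n" "summable e"
    and step: "\<And>n B. B \<in> sets (F n) \<Longrightarrow>
      (\<integral>\<^sup>+\<omega>\<in>B. Y (Suc n) \<omega> \<partial>M) + c n * (\<integral>\<^sup>+\<omega>\<in>B. Y n \<omega> \<partial>M)
        \<le> (\<integral>\<^sup>+\<omega>\<in>B. Y n \<omega> \<partial>M) + e n * emeasure M B"
  shows "AE \<omega> in M. (\<lambda>n. Y n \<omega>) \<longlonglongrightarrow> 0"
proof -
  have [measurable]: "Y n \<in> borel_measurable M" for n
    using measurable_from_subalg[OF sub adapted] .
  have in_M: "B \<in> sets M" if "B \<in> sets (F n)" for B n
    using sub that by (auto simp: subalgebra_def)
  have sp: "space (F n) = space M" for n
    using sub[of n] by (simp add: subalgebra_def)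
  have total: "(\<integral>\<^sup>+\<omega>. Y (Suc n) \<omega> \<partial>M) + c n * (\<integral>\<^sup>+\<omega>. Y n \<omega> \<partial>M) \<le> (\<integral>\<^sup>+\<omega>. Y n \<omega> \<partial>M) + e n" for n
  proof -
    have "space M \<in> sets (F n)" using sets.top[of "F n"] sp by simp
    from step[OF this] show ?thesis
      by (simp add: emeasure_space_1 cong: nn_integral_cong)
  qed
  \<comment> \<open>Finiteness is needed before passing to reals, since \<open>enn2real\<close>
    sends infinity to 0.\<close>
  have fin: "(\<integral>\<^sup>+\<omega>. Y n \<omega> \<partial>M) < \<infinity>" for n
  proof (induction n)
    case (Suc n)
    have "(\<integral>\<^sup>+\<omega>. Y (Suc n) \<omega> \<partial>M) \<le> (\<integral>\<^sup>+\<omega>. Y n \<omega> \<partial>M) + e n"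
      using total[of n] by (meson le_iff_add order_trans)
    also have "\<dots> < \<infinity>" using Suc by simp
    finally show ?case .
  qed (rule Y)
  define a where "a n = enn2real (\<integral>\<^sup>+\<omega>. Y n \<omega> \<partial>M)" for n
  have a: "ennreal (a n) = (\<integral>\<^sup>+\<omega>. Y n \<omega> \<partial>M)" "0 \<le> a n" for n
    using fin[of n] by (auto simp: a_def)
  have "a \<longlonglongrightarrow> 0"
  proof (rule perturbed_contraction_tendsto_zero[OF a(2) c(1) e c(2)])
    fix n
    have "ennreal (a (Suc n)) + ennreal (c n) * ennreal (a n) \<le> ennreal (a n) + ennreal (e n)"
      using total[of n] by (simp only: a(1))
    then have "ennreal (a (Suc n) + c n * a n) \<le> ennreal (a n + e n)"
      using a(2) c(1) e(1) by (simp add: ennreal_mult)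
    then show "a (Suc n) + c n * a n \<le> a n + e n"
      using a(2) e(1) by (subst (asm) ennreal_le_iff) auto
  qed
  \<comment> \<open>The tail of the error series falls by exactly \<open>e n\<close> at step
    \<open>n\<close>. Adding it to \<open>Y n\<close> absorbs the error and gives a true
    supermartingale, while the tail itself vanishes in the limit.\<close>
  define r where "r n = (\<Sum>s. e (s + n))" for n
  have e_shift: "summable (\<lambda>s. e (s + n))" for n
    using e(2) by (simp add: summable_iff_shift)
  have r: "0 \<le> r n" "r n = e n + r (Suc n)" for n
    using suminf_split_head[OF e_shift[of n]] suminf_nonneg[OF e_shift[of n]] e(1)
    by (auto simp: r_def)
  have "r \<longlonglongrightarrow> 0"
    unfolding r_def LIMSEQ_iff using suminf_exist_split[OF _ e(2)] by auto
  define S where "S n \<omega> = ennreal (Y n \<omega>) + ennreal (r n)" for n \<omega>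
  have S_int: "(\<integral>\<^sup>+\<omega>\<in>B. S n \<omega> \<partial>M) = (\<integral>\<^sup>+\<omega>\<in>B. Y n \<omega> \<partial>M) + r n * emeasure M B"
    if "B \<in> sets M" for B n
    using that unfolding S_def distrib_right
    by (subst nn_integral_add) (auto simp: nn_integral_cmult_indicator)
  have maximal: "\<epsilon> * emeasure M {\<omega> \<in> space M. \<exists>t\<ge>T. \<epsilon> \<le> S t \<omega>} \<le> (\<integral>\<^sup>+\<omega>. S T \<omega> \<partial>M)" for T \<epsilon>
  proof (rule supermartingale_maximal_inequality[where F = F, OF sub mono])
    show "S n \<in> borel_measurable (F n)" for n
      unfolding S_def using adapted[of n] by measurable
    fix n B assume B: "B \<in> sets (F n)"
    have "(\<integral>\<^sup>+\<omega>\<in>B. Y (Suc n) \<omega> \<partial>M) \<le> (\<integral>\<^sup>+\<omega>\<in>B. Y n \<omega> \<partial>M) + e n * emeasure M B"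
      using step[OF B] by (meson le_iff_add order_trans)
    then show "(\<integral>\<^sup>+\<omega>\<in>B. S (Suc n) \<omega> \<partial>M) \<le> (\<integral>\<^sup>+\<omega>\<in>B. S n \<omega> \<partial>M)"
      unfolding S_int[OF in_M[OF B]] r(2)[of n] using r(1) e(1)
      by (simp add: distrib_right add.assoc[symmetric] add_right_mono)
  qed
  have eventually_small: "AE \<omega> in M. eventually (\<lambda>t. Y t \<omega> < \<epsilon>) sequentially" if "\<epsilon> > 0" for \<epsilon> :: real
  proof -
    let ?bad = "{\<omega> \<in> space M. \<forall>T. \<exists>t\<ge>T. \<epsilon> \<le> Y t \<omega>}"
    \<comment> \<open>Infinitely many crossings imply a crossing after every \<open>T\<close>, so
      the maximal inequality applies for each \<open>T\<close>; letting \<open>T\<close> grow makes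
      the event null.\<close>
    have "ennreal \<epsilon> * emeasure M ?bad \<le> ennreal (a T + r T)" for T
    proof -
      have "ennreal \<epsilon> * emeasure M ?bad \<le> \<epsilon> * emeasure M {\<omega> \<in> space M. \<exists>t\<ge>T. \<epsilon> \<le> S t \<omega>}"
      proof (intro mult_left_mono emeasure_mono)
        show "?bad \<subseteq> {\<omega> \<in> space M. \<exists>t\<ge>T. \<epsilon> \<le> S t \<omega>}"
          unfolding S_def using Y(1) by (blast intro: add_increasing2 zero_le ennreal_leI)
        show "{\<omega> \<in> space M. \<exists>t\<ge>T. \<epsilon> \<le> S t \<omega>} \<in> sets M"
          unfolding S_def by measurable
      qed simp
      also have "\<dots> \<le> (\<integral>\<^sup>+\<omega>. S T \<omega> \<partial>M)" by (rule maximal)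
      also have "\<dots> = ennreal (a T + r T)"
        using S_int[OF sets.top, of T] r(1)[of T] a[of T]
        by (simp add: emeasure_space_1 cong: nn_integral_cong)
      finally show ?thesis .
    qed
    moreover have "(\<lambda>T. ennreal (a T + r T)) \<longlonglongrightarrow> ennreal (0 + 0)"
      by (intro tendsto_ennrealI tendsto_add \<open>a \<longlonglongrightarrow> 0\<close> \<open>r \<longlonglongrightarrow> 0\<close>)
    ultimately have "ennreal \<epsilon> * emeasure M ?bad \<le> ennreal (0 + 0)"
      by (intro LIMSEQ_le_const) auto
    then have "emeasure M ?bad = 0"
      using that by simp
    then have "AE \<omega> in M. \<not> (\<forall>T. \<exists>t\<ge>T. \<epsilon> \<le> Y t \<omega>)"
      by (intro AE_I[where N = ?bad]) auto
    then show ?thesis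
      by eventually_elim (simp add: eventually_sequentially, meson not_le)
  qed
  \<comment> \<open>Countably many thresholds suffice, so the exceptional null sets can be
    united.\<close>
  have "AE \<omega> in M. \<forall>k. eventually (\<lambda>t. Y t \<omega> < 1 / real (Suc k)) sequentially"
    using eventually_small by (subst AE_all_countable) simp
  then show ?thesis
  proof eventually_elim
    case (elim \<omega>)
    show ?case
    proof (rule order_tendstoI)
      show "eventually (\<lambda>t. Y t \<omega> < \<delta>) sequentially" if "0 < \<delta>" for \<delta>
      proof -
        obtain k where "1 / real (Suc k) < \<delta>"
          using \<open>0 < \<delta>\<close> nat_approx_posE by blast
        with elim[rule_format, of k] show ?thesis
          by (auto elim!: eventually_mono)
      qed
      show "eventually (\<lambda>t. \<delta> < Y t \<omega>) sequentially" if "\<delta> < 0" for \<delta>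
        using less_le_trans[OF that Y(1)] by simp
    qed
  qed
qed

section \<open>Independent samples\<close>

locale iid_sequence = prob_space M + law: prob_space D
  for M :: "'o measure" and D :: "'s measure" +
  fixes \<xi> :: "nat \<Rightarrow> 'o \<Rightarrow> 's"
  assumes indep: "indep_vars (\<lambda>_. D) \<xi> UNIV"
    and distr_eq: "\<And>t. distr M D (\<xi> t) = D"
begin

text \<open>\<open>restrict\<close> makes the initial segment extensional, hence a point of
  \<open>PiM {..<n} (\<lambda>_. D)\<close>. Sample \<open>n\<close> is excluded: iterate
  \<open>n\<close> is built from the samples before it.\<close>

definition past :: "nat \<Rightarrow> 'o \<Rightarrow> nat \<Rightarrow> 's" where
  "past n \<omega> = restrict (\<lambda>i. \<xi> i \<omega>) {..<n}"

definition filtration :: "nat \<Rightarrow> 'o measure" where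
  "filtration n = vimage_algebra (space M) (past n) (PiM {..<n} (\<lambda>_. D))"

lemma measurable_sample [measurable]: "\<xi> t \<in> M \<rightarrow>\<^sub>M D"
  using indep by (auto simp: indep_vars_def)

lemma measurable_past [measurable]: "past n \<in> M \<rightarrow>\<^sub>M PiM {..<n} (\<lambda>_. D)"
  unfolding past_def by measurable

lemma past_space: "past n \<in> space M \<rightarrow> space (PiM {..<n} (\<lambda>_. D))"
  using measurable_space[OF measurable_past] by blast

lemma subalgebra_filtration: "subalgebra M (filtration n)"
  unfolding subalgebra_def filtration_def
  using measurable_sets[OF measurable_past] by (auto simp: sets_vimage_algebra2[OF past_space])

lemma measurable_past_filtration: "past n \<in> filtration n \<rightarrow>\<^sub>M PiM {..<n} (\<lambda>_. D)"
  unfolding filtration_def by (rule measurable_vimage_algebra1[OF past_space])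

lemma filtration_mono: "subalgebra (filtration (Suc n)) (filtration n)"
proof -
  have "(\<lambda>x. restrict x {..<n}) \<in> PiM {..<Suc n} (\<lambda>_. D) \<rightarrow>\<^sub>M PiM {..<n} (\<lambda>_. D)"
    by (rule measurable_restrict_subset) auto
  from measurable_compose[OF measurable_past_filtration this]
  have "(\<lambda>\<omega>. restrict (past (Suc n) \<omega>) {..<n}) \<in> filtration (Suc n) \<rightarrow>\<^sub>M PiM {..<n} (\<lambda>_. D)" .
  moreover have "(\<lambda>\<omega>. restrict (past (Suc n) \<omega>) {..<n}) = past n"
    by (auto simp: past_def fun_eq_iff)
  ultimately have meas: "past n \<in> filtration (Suc n) \<rightarrow>\<^sub>M PiM {..<n} (\<lambda>_. D)" by simp
  have sp: "space (filtration m) = space M" for m by (simp add: filtration_def)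
  show ?thesis
    unfolding subalgebra_def sp
    using measurable_sets[OF meas] unfolding sp
    by (auto simp: filtration_def[of n] sets_vimage_algebra2[OF past_space])
qed

text \<open>The disjoint index blocks \<open>{..<n}\<close> and \<open>{n}\<close> are independent,
  which makes the joint law a product. The second block is a function on the singleton
  \<open>{n}\<close>; evaluating it at \<open>n\<close> recovers the sample, whose law is
  \<open>D\<close>.\<close>

lemma distr_past_sample:
  "distr M (PiM {..<n} (\<lambda>_. D) \<Otimes>\<^sub>M D) (\<lambda>\<omega>. (past n \<omega>, \<xi> n \<omega>)) =
    distr M (PiM {..<n} (\<lambda>_. D)) (past n) \<Otimes>\<^sub>M D"
proof -
  let ?P = "PiM {..<n} (\<lambda>_. D)" and ?Q = "PiM {n} (\<lambda>_. D)"
  let ?R = "\<lambda>\<omega>. restrict (\<lambda>i. \<xi> i \<omega>) {n}"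
  have [measurable]: "?R \<in> M \<rightarrow>\<^sub>M ?Q" by measurable
  have [measurable]: "(\<lambda>y. y n) \<in> ?Q \<rightarrow>\<^sub>M D" by (rule measurable_component_singleton) simp
  have "indep_var ?P (past n) ?Q ?R"
    unfolding past_def by (rule indep_var_restrict[OF indep]) auto
  then have joint: "distr M ?P (past n) \<Otimes>\<^sub>M distr M ?Q ?R = distr M (?P \<Otimes>\<^sub>M ?Q) (\<lambda>\<omega>. (past n \<omega>, ?R \<omega>))"
    unfolding indep_var_distribution_eq by simp
  have marginal: "distr (distr M ?Q ?R) D (\<lambda>y. y n) = D"
    by (subst distr_distr) (simp_all add: comp_def distr_eq)
  have "distr M (?P \<Otimes>\<^sub>M D) (\<lambda>\<omega>. (past n \<omega>, \<xi> n \<omega>))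
      = distr (distr M (?P \<Otimes>\<^sub>M ?Q) (\<lambda>\<omega>. (past n \<omega>, ?R \<omega>))) (?P \<Otimes>\<^sub>M D) (\<lambda>(x, y). (x, y n))"
    by (subst distr_distr) (simp_all add: comp_def)
  also have "\<dots> = distr (distr M ?P (past n)) ?P (\<lambda>x. x) \<Otimes>\<^sub>M distr (distr M ?Q ?R) D (\<lambda>y. y n)"
    unfolding joint[symmetric]
    by (subst pair_measure_distr) (simp_all add: marginal law.sigma_finite_measure_axioms)
  also have "\<dots> = distr M ?P (past n) \<Otimes>\<^sub>M D"
    unfolding marginal by (simp add: distr_distr comp_def)
  finally show ?thesis .
qed

text \<open>Tonelli for the product law: the past is frozen and the fresh sample is averaged out
  under \<open>D\<close>. This takes the place of conditioning on the past.\<close>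

lemma nn_integral_past_sample:
  assumes h: "h \<in> borel_measurable (PiM {..<n} (\<lambda>_. D) \<Otimes>\<^sub>M D)"
  shows "(\<integral>\<^sup>+\<omega>. h (past n \<omega>, \<xi> n \<omega>) \<partial>M) = (\<integral>\<^sup>+\<omega>. (\<integral>\<^sup>+y. h (past n \<omega>, y) \<partial>D) \<partial>M)"
proof -
  have h': "h \<in> borel_measurable (distr M (PiM {..<n} (\<lambda>_. D)) (past n) \<Otimes>\<^sub>M D)"
    using h by (simp cong: measurable_cong_sets sets_pair_measure_cong)
  have "(\<integral>\<^sup>+\<omega>. h (past n \<omega>, \<xi> n \<omega>) \<partial>M)
      = (\<integral>\<^sup>+p. h p \<partial>distr M (PiM {..<n} (\<lambda>_. D) \<Otimes>\<^sub>M D) (\<lambda>\<omega>. (past n \<omega>, \<xi> n \<omega>)))"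
    using h by (subst nn_integral_distr) auto
  also have "\<dots> = (\<integral>\<^sup>+x. (\<integral>\<^sup>+y. h (x, y) \<partial>D) \<partial>distr M (PiM {..<n} (\<lambda>_. D)) (past n))"
    unfolding distr_past_sample by (rule law.nn_integral_fst[OF h', symmetric])
  also have "\<dots> = (\<integral>\<^sup>+\<omega>. (\<integral>\<^sup>+y. h (past n \<omega>, y) \<partial>D) \<partial>M)"
    using law.borel_measurable_nn_integral_fst[OF h] by (subst nn_integral_distr) auto
  finally show ?thesis .
qed

end

section \<open>Stochastic gradient descent\<close>

text \<open>The point \<open>w\<close> is approximated by simple functions \<open>q i w\<close>.
  Each takes finitely many values, so substituting it needs measurability only at fixed points;
  continuity in \<open>w\<close> passes to the limit.\<close>

lemma borel_measurable_caratheodory: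
  fixes g :: "'a::{metric_space, second_countable_topology} \<Rightarrow> 's \<Rightarrow> 'b::{metric_space, second_countable_topology}"
  assumes meas: "\<And>w. g w \<in> borel_measurable D"
    and cont: "\<And>x. x \<in> space D \<Longrightarrow> continuous_on UNIV (\<lambda>w. g w x)"
  shows "(\<lambda>p. g (fst p) (snd p)) \<in> borel_measurable (borel \<Otimes>\<^sub>M D)"
proof -
  obtain q :: "nat \<Rightarrow> 'a \<Rightarrow> 'a"
    where q: "\<And>i. simple_function borel (q i)" "\<And>w. (\<lambda>i. q i w) \<longlonglongrightarrow> w"
    using borel_measurable_implies_sequence_metric[of "\<lambda>w::'a. w" borel undefined] by auto
  have "(\<lambda>p. g (q i (fst p)) (snd p)) \<in> borel_measurable (borel \<Otimes>\<^sub>M D)" for i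
  proof (rule measurable_compose_countable'[where I = "range (q i)"])
    show "(\<lambda>p. g v (snd p)) \<in> borel_measurable (borel \<Otimes>\<^sub>M D)" for v
      using measurable_compose[OF measurable_snd meas] .
    have "q i \<in> borel \<rightarrow>\<^sub>M count_space (range (q i))"
      using simple_functionD[OF q(1)] by (subst measurable_count_space_eq2) auto
    then show "(\<lambda>p. q i (fst p)) \<in> borel \<Otimes>\<^sub>M D \<rightarrow>\<^sub>M count_space (range (q i))"
      using measurable_compose[OF measurable_fst] by blast
    show "countable (range (q i))"
      using simple_functionD(1)[OF q(1)[of i]] by (simp add: countable_finite)
  qed
  moreover have "(\<lambda>i. g (q i (fst p)) (snd p)) \<longlonglongrightarrow> g (fst p) (snd p)"
    if "p \<in> space (borel \<Otimes>\<^sub>M D)" for p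
  proof -
    have "isCont (\<lambda>w. g w (snd p)) (fst p)"
      using cont[of "snd p"] that by (auto simp: space_pair_measure continuous_on_eq_continuous_at)
    then show ?thesis
      using q(2) by (rule isCont_tendsto_compose)
  qed
  ultimately show ?thesis
    by (rule borel_measurable_LIMSEQ_metric)
qed

section \<open>Moment bounds for the stochastic gradient and one-step descent\<close>

locale sgd_problem = law: prob_space D
  for D :: "'s measure" +
  fixes f :: "'a::euclidean_space \<Rightarrow> 's \<Rightarrow> real" and \<mu> L :: real and wstar :: 'a
  assumes unbiased: "unbiased_gradient D f"
    and strongly_convex: "strongly_convex \<mu> (objective D f)"
    and smooth: "\<And>x. x \<in> space D \<Longrightarrow> smooth L (\<lambda>w. f w x)"
    and L_pos: "L > 0"
    and minimizer: "is_arg_min (objective D f) (\<lambda>_. True) wstar"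
    and noise_integrable: "integrable D (\<lambda>x. (norm (grad (\<lambda>w. f w x) wstar))\<^sup>2)"
begin

definition stoch_grad :: "'a \<Rightarrow> 's \<Rightarrow> 'a" where
  "stoch_grad w x = grad (\<lambda>v. f v x) w"

definition noise :: real where
  "noise = (\<integral>x. (norm (stoch_grad wstar x))\<^sup>2 \<partial>D)"

lemma noise_nonneg: "0 \<le> noise"
  unfolding noise_def by simp

lemma stoch_grad_integrable: "integrable D (stoch_grad w)"
  using unbiased by (simp add: unbiased_gradient_def stoch_grad_def[abs_def])

lemma integral_stoch_grad: "(\<integral>x. stoch_grad w x \<partial>D) = grad (objective D f) w"
  using unbiased by (simp add: unbiased_gradient_def stoch_grad_def)

lemma stoch_grad_measurable [measurable]: "stoch_grad w \<in> borel_measurable D"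
  using borel_measurable_integrable[OF stoch_grad_integrable] .

lemma stoch_grad_lipschitz: "x \<in> space D \<Longrightarrow> norm (stoch_grad w x - stoch_grad w' x) \<le> L * norm (w - w')"
  using smooth by (simp add: smooth_def stoch_grad_def)

text \<open>The iteration evaluates the gradient at a random point, so measurability at each fixed
  \<open>w\<close> is not enough. Smoothness supplies the missing continuity in
  \<open>w\<close>.\<close>

lemma stoch_grad_jointly_measurable [measurable]: "(\<lambda>p. stoch_grad (fst p) (snd p)) \<in> borel_measurable (borel \<Otimes>\<^sub>M D)"
proof (rule borel_measurable_caratheodory)
  fix x assume "x \<in> space D"
  then have "L-lipschitz_on UNIV (\<lambda>w. stoch_grad w x)"
    using L_pos stoch_grad_lipschitz by (intro lipschitz_onI) (auto simp: dist_norm)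
  then show "continuous_on UNIV (\<lambda>w. stoch_grad w x)"
    by (rule lipschitz_on_continuous_on)
qed simp

lemma grad_minimizer: "grad (objective D f) wstar = 0"
proof -
  let ?F = "objective D f"
  have "GDERIV ?F wstar :> grad ?F wstar"
    using strongly_convex by (intro GDERIV_grad) (simp add: strongly_convex_def)
  then have "(\<lambda>h. h \<bullet> grad ?F wstar) = (\<lambda>h. 0)"
    unfolding gderiv_def using minimizer
    by (intro differential_zero_maxmin[of wstar UNIV ?F]) (auto simp: is_arg_min_linorder)
  then have "grad ?F wstar \<bullet> grad ?F wstar = 0" by metis
  then show ?thesis by simp
qed

text \<open>Adding the strong convexity inequalities for the pair in both orders cancels the
  objective values, and the gradient at \<open>wstar\<close> vanishes.\<close>

lemma strong_monotonicity: "\<mu> * (norm (w - wstar))\<^sup>2 \<le> grad (objective D f) w \<bullet> (w - wstar)"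
proof -
  let ?F = "objective D f"
  have "?F w - ?F v \<ge> grad ?F v \<bullet> (w - v) + \<mu> / 2 * (norm (w - v))\<^sup>2" for w v
    using strongly_convex by (simp add: strongly_convex_def)
  from this[of w wstar] this[of wstar w] show ?thesis
    by (simp add: grad_minimizer norm_minus_commute inner_diff_right algebra_simps)
qed

text \<open>The gradient at \<open>w\<close> differs from the one at \<open>wstar\<close> by at most
  \<open>L * norm (w - wstar)\<close>; squaring with (a + b)^2 <= 2 a^2 + 2 b^2 separates the
  distance from the noise.\<close>

lemma stoch_grad_second_moment:
  shows "integrable D (\<lambda>x. (norm (stoch_grad w x))\<^sup>2)"
    and "(\<integral>x. (norm (stoch_grad w x))\<^sup>2 \<partial>D) \<le> 2 * L\<^sup>2 * (norm (w - wstar))\<^sup>2 + 2 * noise"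
proof -
  have bound: "(norm (stoch_grad w x))\<^sup>2 \<le> 2 * L\<^sup>2 * (norm (w - wstar))\<^sup>2 + 2 * (norm (stoch_grad wstar x))\<^sup>2"
    if "x \<in> space D" for x
  proof -
    have "norm (stoch_grad w x) \<le> norm (stoch_grad w x - stoch_grad wstar x) + norm (stoch_grad wstar x)"
      using norm_triangle_ineq[of "stoch_grad w x - stoch_grad wstar x" "stoch_grad wstar x"] by simp
    also have "\<dots> \<le> L * norm (w - wstar) + norm (stoch_grad wstar x)"
      using stoch_grad_lipschitz[OF that] by simp
    finally have "(norm (stoch_grad w x))\<^sup>2 \<le> (L * norm (w - wstar) + norm (stoch_grad wstar x))\<^sup>2"
      by (simp add: power_mono)
    also have "\<dots> \<le> 2 * L\<^sup>2 * (norm (w - wstar))\<^sup>2 + 2 * (norm (stoch_grad wstar x))\<^sup>2"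
      using sum_squares_bound[of "L * norm (w - wstar)" "norm (stoch_grad wstar x)"]
      by (simp add: power2_sum power_mult_distrib algebra_simps)
    finally show ?thesis .
  qed
  have dominating: "integrable D (\<lambda>x. 2 * L\<^sup>2 * (norm (w - wstar))\<^sup>2 + 2 * (norm (stoch_grad wstar x))\<^sup>2)"
    using noise_integrable by (simp add: stoch_grad_def)
  show int: "integrable D (\<lambda>x. (norm (stoch_grad w x))\<^sup>2)"
    using bound by (intro Bochner_Integration.integrable_bound[OF dominating]) auto
  have "(\<integral>x. (norm (stoch_grad w x))\<^sup>2 \<partial>D)
      \<le> (\<integral>x. 2 * L\<^sup>2 * (norm (w - wstar))\<^sup>2 + 2 * (norm (stoch_grad wstar x))\<^sup>2 \<partial>D)"
    using bound by (intro integral_mono int dominating)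
  also have "\<dots> = 2 * L\<^sup>2 * (norm (w - wstar))\<^sup>2 + 2 * noise"
    using noise_integrable by (simp add: stoch_grad_def noise_def law.prob_space)
  finally show "(\<integral>x. (norm (stoch_grad w x))\<^sup>2 \<partial>D) \<le> 2 * L\<^sup>2 * (norm (w - wstar))\<^sup>2 + 2 * noise" .
qed

text \<open>Expanding the square, the cross term yields a decrease of \<open>2 * h * \<mu>\<close>
  times the squared distance. The second moment costs \<open>2 * h^2 * L^2\<close> times it, at most
  half of that decrease by the step size bound, so \<open>h * \<mu>\<close> times it
  survives.\<close>

lemma expected_step:
  assumes h: "0 \<le> h" "2 * L\<^sup>2 * h \<le> \<mu>"
  shows "(\<integral>\<^sup>+x. (norm (w - h *\<^sub>R stoch_grad w x - wstar))\<^sup>2 \<partial>D) + ennreal (h * \<mu>) * ennreal ((norm (w - wstar))\<^sup>2)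
    \<le> ennreal ((norm (w - wstar))\<^sup>2) + ennreal (2 * h\<^sup>2 * noise)"
proof -
  have expand: "(norm (w - h *\<^sub>R stoch_grad w x - wstar))\<^sup>2
      = (norm (w - wstar))\<^sup>2 - 2 * h * (stoch_grad w x \<bullet> (w - wstar)) + h\<^sup>2 * (norm (stoch_grad w x))\<^sup>2" for x
    unfolding cancel_ab_semigroup_add_class.diff_right_commute[of w _ wstar] using dot_norm_neg[of "w - wstar" "h *\<^sub>R stoch_grad w x"]
    by (simp add: power_mult_distrib inner_commute)
  have int: "integrable D (\<lambda>x. (norm (w - h *\<^sub>R stoch_grad w x - wstar))\<^sup>2)"
    unfolding expand using stoch_grad_integrable stoch_grad_second_moment(1) by simp
  have "(\<integral>x. (norm (w - h *\<^sub>R stoch_grad w x - wstar))\<^sup>2 \<partial>D)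
      = (norm (w - wstar))\<^sup>2 - 2 * h * (grad (objective D f) w \<bullet> (w - wstar))
        + h\<^sup>2 * (\<integral>x. (norm (stoch_grad w x))\<^sup>2 \<partial>D)"
    unfolding expand using stoch_grad_integrable[of w] stoch_grad_second_moment(1)[of w]
    by (simp add: law.prob_space integral_stoch_grad)
  also have "\<dots> \<le> (norm (w - wstar))\<^sup>2 - 2 * h * (\<mu> * (norm (w - wstar))\<^sup>2)
      + h\<^sup>2 * (2 * L\<^sup>2 * (norm (w - wstar))\<^sup>2 + 2 * noise)"
    using h(1) by (intro add_mono diff_mono mult_left_mono strong_monotonicity stoch_grad_second_moment(2)) auto
  also have "\<dots> \<le> (norm (w - wstar))\<^sup>2 - h * \<mu> * (norm (w - wstar))\<^sup>2 + 2 * h\<^sup>2 * noise"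
  proof -
    have "2 * L\<^sup>2 * h * (h * (norm (w - wstar))\<^sup>2) \<le> \<mu> * (h * (norm (w - wstar))\<^sup>2)"
      using h by (intro mult_right_mono) auto
    then show ?thesis by (simp add: algebra_simps power2_eq_square)
  qed
  finally have real: "(\<integral>x. (norm (w - h *\<^sub>R stoch_grad w x - wstar))\<^sup>2 \<partial>D) + h * \<mu> * (norm (w - wstar))\<^sup>2
      \<le> (norm (w - wstar))\<^sup>2 + 2 * h\<^sup>2 * noise"
    by simp
  \<comment> \<open>The sign of \<open>\<mu>\<close> is read off the step size condition; it is
    needed to split the product in \<open>ennreal\<close>.\<close>
  have "0 \<le> \<mu>"
    using h by (meson mult_nonneg_nonneg order_trans zero_le_numeral zero_le_power2)
  then have "ennreal (\<integral>x. (norm (w - h *\<^sub>R stoch_grad w x - wstar))\<^sup>2 \<partial>D) + ennreal (h * \<mu>) * ennreal ((norm (w - wstar))\<^sup>2)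
      = ennreal ((\<integral>x. (norm (w - h *\<^sub>R stoch_grad w x - wstar))\<^sup>2 \<partial>D) + h * \<mu> * (norm (w - wstar))\<^sup>2)"
    using h by (simp add: ennreal_mult)
  also have "\<dots> \<le> ennreal ((norm (w - wstar))\<^sup>2 + 2 * h\<^sup>2 * noise)"
    by (rule ennreal_leI[OF real])
  also have "\<dots> = ennreal ((norm (w - wstar))\<^sup>2) + ennreal (2 * h\<^sup>2 * noise)"
    using noise_nonneg by simp
  finally show ?thesis
    by (subst nn_integral_eq_integral[OF int]) auto
qed

text \<open>This allows the full sample sequence to be replaced by \<open>past n\<close> in iterate
  \<open>n\<close>.\<close>

lemma sgd_cong: "(\<And>i. i < n \<Longrightarrow> x i = y i) \<Longrightarrow> sgd f \<eta> x w0 n = sgd f \<eta> y w0 n"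
  by (induction n) auto

text \<open>The horizon \<open>m\<close> stays fixed while \<open>n\<close> grows, so the induction
  runs on a single product space; step \<open>n\<close> reads coordinate \<open>n\<close>, which
  lies below \<open>m\<close> because \<open>Suc n \<le> m\<close>.\<close>

lemma measurable_sgd:
  "n \<le> m \<Longrightarrow> (\<lambda>x. sgd f \<eta> x w0 n) \<in> borel_measurable (PiM {..<m} (\<lambda>_. D))"
proof (induction n)
  case (Suc n)
  then have [measurable]: "(\<lambda>x. sgd f \<eta> x w0 n) \<in> borel_measurable (PiM {..<m} (\<lambda>_. D))"
    by simp
  have [measurable]: "(\<lambda>x. x n) \<in> PiM {..<m} (\<lambda>_. D) \<rightarrow>\<^sub>M D"
    using Suc.prems by (intro measurable_component_singleton) simp
  have "(\<lambda>x. (sgd f \<eta> x w0 n, x n)) \<in> PiM {..<m} (\<lambda>_. D) \<rightarrow>\<^sub>M borel \<Otimes>\<^sub>M D"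
    by measurable
  from measurable_compose[OF this stoch_grad_jointly_measurable]
  have "(\<lambda>x. stoch_grad (sgd f \<eta> x w0 n) (x n)) \<in> borel_measurable (PiM {..<m} (\<lambda>_. D))"
    by simp
  then show ?case by (simp flip: stoch_grad_def)
qed simp

end

section \<open>The squared distance as a perturbed contraction\<close>

locale sgd_iteration = iid_sequence M D \<xi> + sgd_problem D f \<mu> L wstar
  for M :: "'o measure" and D :: "'s measure" and \<xi> f \<mu> L and wstar :: "'a::euclidean_space" +
  fixes \<eta> :: "nat \<Rightarrow> real" and w0 :: 'a
  assumes mu_pos: "\<mu> > 0"
    and eta_pos: "\<And>t. 0 < \<eta> t"
    and eta_le: "\<And>t. 2 * L\<^sup>2 * \<eta> t \<le> \<mu>"
    and eta_div: "filterlim (\<lambda>n. \<Sum>t<n. \<eta> t) at_top sequentially"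
    and eta_sq: "summable (\<lambda>t. (\<eta> t)\<^sup>2)"
begin

definition sqdist :: "nat \<Rightarrow> 'o \<Rightarrow> real" where
  "sqdist n \<omega> = (norm (sgd f \<eta> (\<lambda>i. \<xi> i \<omega>) w0 n - wstar))\<^sup>2"

lemma sqdist_past: "sqdist n \<omega> = (norm (sgd f \<eta> (past n \<omega>) w0 n - wstar))\<^sup>2"
  unfolding sqdist_def by (subst sgd_cong[of n _ "past n \<omega>"]) (auto simp: past_def)

lemma sqdist_Suc_past:
  "sqdist (Suc n) \<omega> =
    (norm (sgd f \<eta> (past n \<omega>) w0 n - \<eta> n *\<^sub>R stoch_grad (sgd f \<eta> (past n \<omega>) w0 n) (\<xi> n \<omega>) - wstar))\<^sup>2"
proof -
  have "sgd f \<eta> (\<lambda>i. \<xi> i \<omega>) w0 n = sgd f \<eta> (past n \<omega>) w0 n"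
    by (rule sgd_cong) (simp add: past_def)
  then show ?thesis by (simp add: sqdist_def stoch_grad_def)
qed

lemma sqdist_adapted: "sqdist n \<in> borel_measurable (filtration n)"
proof -
  have [measurable]: "(\<lambda>\<omega>. sgd f \<eta> (past n \<omega>) w0 n) \<in> borel_measurable (filtration n)"
    by (rule measurable_compose[OF measurable_past_filtration measurable_sgd]) simp
  show ?thesis
    unfolding sqdist_past by measurable
qed

text \<open>This is \<open>expected_step\<close> at the iterate determined by the past, integrated
  over an event of the past.\<close>

lemma sqdist_step:
  assumes "B \<in> sets (filtration n)"
  shows "(\<integral>\<^sup>+\<omega>\<in>B. sqdist (Suc n) \<omega> \<partial>M) + ennreal (\<eta> n * \<mu>) * (\<integral>\<^sup>+\<omega>\<in>B. sqdist n \<omega> \<partial>M)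
    \<le> (\<integral>\<^sup>+\<omega>\<in>B. sqdist n \<omega> \<partial>M) + ennreal (2 * (\<eta> n)\<^sup>2 * noise) * emeasure M B"
proof -
  obtain C where C [measurable]: "C \<in> sets (PiM {..<n} (\<lambda>_. D))" and B: "B = past n -` C \<inter> space M"
    using assms unfolding filtration_def sets_vimage_algebra2[OF past_space] by blast
  have B_M [measurable]: "B \<in> sets M" unfolding B by measurable
  have [measurable]: "sqdist n \<in> borel_measurable M"
    by (rule measurable_from_subalg[OF subalgebra_filtration sqdist_adapted])
  have ind: "indicator B \<omega> = (indicator C (past n \<omega>) :: ennreal)" if "\<omega> \<in> space M" for \<omega>
    using that by (simp add: B indicator_def)
  \<comment> \<open>The next squared distance, cut off to the event, becomes a function of the pair
    (past, fresh sample), the form to which \<open>nn_integral_past_sample\<close> applies.\<close>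
  define h where "h p = ennreal ((norm (sgd f \<eta> (fst p) w0 n
      - \<eta> n *\<^sub>R stoch_grad (sgd f \<eta> (fst p) w0 n) (snd p) - wstar))\<^sup>2) * indicator C (fst p)" for p
  note [measurable] = measurable_sgd[OF order_refl, of \<eta> w0 n]
  have "(\<lambda>p. (sgd f \<eta> (fst p) w0 n, snd p)) \<in> PiM {..<n} (\<lambda>_. D) \<Otimes>\<^sub>M D \<rightarrow>\<^sub>M borel \<Otimes>\<^sub>M D"
    by measurable
  from measurable_compose[OF this stoch_grad_jointly_measurable]
  have [measurable]: "(\<lambda>p. stoch_grad (sgd f \<eta> (fst p) w0 n) (snd p)) \<in> borel_measurable (PiM {..<n} (\<lambda>_. D) \<Otimes>\<^sub>M D)"
    by simp
  have h_meas [measurable]: "h \<in> borel_measurable (PiM {..<n} (\<lambda>_. D) \<Otimes>\<^sub>M D)"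
    unfolding h_def by measurable
  have inner_meas [measurable]: "(\<lambda>\<omega>. \<integral>\<^sup>+y. h (past n \<omega>, y) \<partial>D) \<in> borel_measurable M"
    by (rule measurable_compose[OF measurable_past law.borel_measurable_nn_integral_fst[OF h_meas]])
  have "(\<integral>\<^sup>+\<omega>\<in>B. sqdist (Suc n) \<omega> \<partial>M) = (\<integral>\<^sup>+\<omega>. h (past n \<omega>, \<xi> n \<omega>) \<partial>M)"
    by (intro nn_integral_cong) (simp add: h_def sqdist_Suc_past ind)
  also have "\<dots> = (\<integral>\<^sup>+\<omega>. (\<integral>\<^sup>+y. h (past n \<omega>, y) \<partial>D) \<partial>M)"
    by (rule nn_integral_past_sample[OF h_meas])
  finally have "(\<integral>\<^sup>+\<omega>\<in>B. sqdist (Suc n) \<omega> \<partial>M) + ennreal (\<eta> n * \<mu>) * (\<integral>\<^sup>+\<omega>\<in>B. sqdist n \<omega> \<partial>M)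
      = (\<integral>\<^sup>+\<omega>. (\<integral>\<^sup>+y. h (past n \<omega>, y) \<partial>D) + ennreal (\<eta> n * \<mu>) * (ennreal (sqdist n \<omega>) * indicator B \<omega>) \<partial>M)"
    by (simp add: nn_integral_add nn_integral_cmult)
  also have "\<dots> \<le> (\<integral>\<^sup>+\<omega>. ennreal (sqdist n \<omega>) * indicator B \<omega> + ennreal (2 * (\<eta> n)\<^sup>2 * noise) * indicator B \<omega> \<partial>M)"
  proof (rule nn_integral_mono)
    fix \<omega> assume \<omega>: "\<omega> \<in> space M"
    show "(\<integral>\<^sup>+y. h (past n \<omega>, y) \<partial>D) + ennreal (\<eta> n * \<mu>) * (ennreal (sqdist n \<omega>) * indicator B \<omega>)
      \<le> ennreal (sqdist n \<omega>) * indicator B \<omega> + ennreal (2 * (\<eta> n)\<^sup>2 * noise) * indicator B \<omega>"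
      \<comment> \<open>For a frozen past outside \<open>C\<close> every term is 0; inside
        \<open>C\<close> the claim is \<open>expected_step\<close> at the current iterate.\<close>
      using expected_step[OF less_imp_le[OF eta_pos] eta_le, of "sgd f \<eta> (past n \<omega>) w0 n" n]
      by (cases "past n \<omega> \<in> C") (simp_all add: h_def ind[OF \<omega>] sqdist_past)
  qed
  also have "\<dots> = (\<integral>\<^sup>+\<omega>\<in>B. sqdist n \<omega> \<partial>M) + ennreal (2 * (\<eta> n)\<^sup>2 * noise) * emeasure M B"
    by (subst nn_integral_add) (auto simp: nn_integral_cmult_indicator)
  finally show ?thesis .
qed

text \<open>The contraction weights are \<open>\<eta> n * \<mu>\<close> and the errors
  \<open>2 * (\<eta> n)^2 * noise\<close>: divergence of the step sizes and summability of their
  squares are what the convergence lemma asks for. The initial expectation is finite because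
  \<open>w0\<close> is deterministic.\<close>

lemma sqdist_AE_tendsto_zero: "AE \<omega> in M. (\<lambda>n. sqdist n \<omega>) \<longlonglongrightarrow> 0"
proof (rule perturbed_contraction_AE_tendsto_zero[where F = filtration,
      OF subalgebra_filtration filtration_mono sqdist_adapted])
  show "(\<integral>\<^sup>+\<omega>. sqdist 0 \<omega> \<partial>M) < \<infinity>"
    by (simp add: sqdist_def emeasure_space_1)
  show "filterlim (\<lambda>n. \<Sum>t<n. \<eta> t * \<mu>) at_top sequentially"
    unfolding sum_distrib_right[symmetric]
    using filterlim_tendsto_pos_mult_at_top[OF tendsto_const mu_pos eta_div] by (simp add: mult.commute)
  show "summable (\<lambda>n. 2 * (\<eta> n)\<^sup>2 * noise)"
    by (intro summable_mult summable_mult2 eta_sq)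
  show "0 \<le> \<eta> n * \<mu>" for n
    using eta_pos[of n] mu_pos by simp
  show "0 \<le> 2 * (\<eta> n)\<^sup>2 * noise" for n
    using noise_nonneg by simp
  show "0 \<le> sqdist n \<omega>" for n \<omega>
    by (simp add: sqdist_def)
qed (rule sqdist_step)

end

theorem theorem3:
  fixes M :: "'o measure"
    and D :: "'s measure"
    and \<xi> :: "nat \<Rightarrow> 'o \<Rightarrow> 's"
    and f :: "real ^ 'd \<Rightarrow> 's \<Rightarrow> real"
    and \<eta> :: "nat \<Rightarrow> real"
    and \<mu> L \<kappa> :: real
    and w0 wstar :: "real ^ 'd"
  assumes "prob_space M"
    and "prob_space D"
    and "prob_space.indep_vars M (\<lambda>_. D) \<xi> UNIV"
    and "\<And>t. distr M D (\<xi> t) = D"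
    and "\<And>w. integrable D (f w)"
    and "unbiased_gradient D f"
    and "\<mu> > 0"
    and "strongly_convex \<mu> (objective D f)"
    and "L > 0"
    and "\<And>x. x \<in> space D \<Longrightarrow> smooth L (\<lambda>w. f w x)"
    and "\<kappa> = L / \<mu>"
    and "is_arg_min (objective D f) (\<lambda>_. True) wstar"
    and "integrable D (\<lambda>x. (norm (grad (\<lambda>w. f w x) wstar))\<^sup>2)"
    and "\<And>t. 0 < \<eta> t"
    and "\<And>t. \<eta> t \<le> 1 / (2 * L * \<kappa>)"
    and "filterlim (\<lambda>n. \<Sum>t<n. \<eta> t) at_top sequentially"
    and "summable (\<lambda>t. (\<eta> t)\<^sup>2)"
  shows "AE \<omega> in M.
    (\<lambda>t. (norm (sgd f \<eta> (\<lambda>s. \<xi> s \<omega>) w0 t - wstar))\<^sup>2) \<longlonglongrightarrow> 0"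
proof -
  interpret M: prob_space M by fact
  interpret D: prob_space D by fact
  interpret sgd_iteration M D \<xi> f \<mu> L wstar \<eta> w0
  proof
    \<comment> \<open>With \<open>\<kappa> = L / \<mu>\<close> the bound
      \<open>1 / (2 * L * \<kappa>)\<close> equals \<open>\<mu> / (2 * L^2)\<close>.\<close>
    show "2 * L\<^sup>2 * \<eta> t \<le> \<mu>" for t
      using assms(15)[of t] \<open>\<mu> > 0\<close> \<open>L > 0\<close> \<open>\<kappa> = L / \<mu>\<close>
      by (simp add: field_simps power2_eq_square)
  qed (use assms in auto)
  show ?thesis
    using sqdist_AE_tendsto_zero unfolding sqdist_def .
qed

end
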